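(* Let $(S,\mu,x_0)$ be a biunital Lie semiheap, and let $v\in \mathsf{T}_{x_0}S$ be a given non-zero tangent vector. Then the map $V:S\to\mathsf{T}S$ given by $x\mapsto(\mathrm{d}L_{xx_0})_{x_0}v$ defines a smooth vector field on $S$ that is left-invariant and satisfies $V(x_0)=v$.
   Context: All manifolds are real, finite dimensional, Hausdorff, second countable smooth manifolds. A Lie semiheap is a smooth manifold $S$ with a smooth map $\mu:S^3\to S$, $\mu(x,y,z)=[x,y,z]$, satisfying the para-associative law $[[x_1,x_2,x_3],x_4,x_5]=[x_1,[x_4,x_3,x_2],x_5]=[x_1,x_2,[x_3,x_4,x_5]]$ for all $x_i\in S$. A biunital Lie semiheap $(S,\mu,x_0)$ is a Lie semiheap with a distinguished point $x_0\in S$ such that $[x,x_0,x_0]=x=[x_0,x_0,x]$ for all $x\in S$. For $x,y\in S$ the left translation $L_{xy}:S\to S$ is $L_{xy}(z)=[x,y,z]$, with derivative $(\mathrm{d}L_{xy})_z:\mathsf{T}_zS\to\mathsf{T}_{[x,y,z]}S$; $L(S)$ denotes the set of all left translations. A vector field $X$ on $S$ is left-invariant if $l^*\circ X=X\circ l^*$ as operators on $C^\infty(S)$ for all $l\in L(S)$; equivalently $(\mathrm{d}L_{xy})_zX_z=X_{[x,y,z]}$ for all $x,y,z\in S$. *)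

theory Defs
  imports "HOL-Analysis.Analysis"
begin

section \<open>Smooth functions between Euclidean spaces\<close>

text \<open>
  \<open>Ck_on k U f\<close> says that \<open>f\<close> is of class \<open>C^k\<close> on \<open>U\<close>; it is meant for open \<open>U\<close> only.
  The second argument of the recursion is the directional derivative \<open>x \<mapsto> Df(x) h\<close>; as the
  domain is finite dimensional, controlling it for every \<open>h\<close> controls \<open>x \<mapsto> Df(x)\<close>.
\<close>

primrec Ck_on :: "nat \<Rightarrow> 'e::euclidean_space set \<Rightarrow> ('e \<Rightarrow> 'f::euclidean_space) \<Rightarrow> bool" where
  "Ck_on 0 U f \<longleftrightarrow> continuous_on U f"
| "Ck_on (Suc k) U f \<longleftrightarrow>
     (\<forall>x\<in>U. f differentiable (at x)) \<and>
     (\<forall>h. Ck_on k U (\<lambda>x. frechet_derivative f (at x) h))"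

definition smooth_on :: "'e::euclidean_space set \<Rightarrow> ('e \<Rightarrow> 'f::euclidean_space) \<Rightarrow> bool" where
  "smooth_on U f \<longleftrightarrow> (\<forall>k. Ck_on k U f)"


section \<open>Manifolds\<close>

text \<open>
  A chart is a pair of its domain and its coordinate map; the values of the coordinate map
  outside the domain are irrelevant. The carrier of a manifold is the \<open>topspace\<close> of its topology.
  The atlas need not be maximal: any smooth atlas determines the smooth structure, and the
  notions below depend only on that structure (up to the evident identifications).
  The dimension is \<open>DIM('e)\<close>, hence at least 1; a 0-dimensional manifold has no non-zero tangent vector.
\<close>

type_synonym ('a, 'e) chart = "'a set \<times> ('a \<Rightarrow> 'e)"

abbreviation chart_inv :: "('a, 'e) chart \<Rightarrow> 'e \<Rightarrow> 'a" where
  "chart_inv c \<equiv> inv_into (fst c) (snd c)"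

record ('a, 'e) manifold =
  mtopology :: "'a topology"
  atlas :: "('a, 'e) chart set"

abbreviation points :: "('a, 'e) manifold \<Rightarrow> 'a set" where
  "points M \<equiv> topspace (mtopology M)"

locale smooth_manifold =
  fixes M :: "('a, 'e::euclidean_space) manifold"
  assumes Hausdorff: "Hausdorff_space (mtopology M)"
    and second_countable: "second_countable (mtopology M)"
    and covers: "(\<Union>c\<in>atlas M. fst c) = points M"
    and chart_open: "c \<in> atlas M \<Longrightarrow> openin (mtopology M) (fst c)"
    and chart_image_open: "c \<in> atlas M \<Longrightarrow> open (snd c ` fst c)"
    and chart_homeomorphic: "c \<in> atlas M \<Longrightarrow>
      homeomorphic_map (subtopology (mtopology M) (fst c)) (top_of_set (snd c ` fst c)) (snd c)"
    and charts_compatible: "c \<in> atlas M \<Longrightarrow> d \<in> atlas M \<Longrightarrow>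
      smooth_on (snd c ` (fst c \<inter> fst d)) (snd d \<circ> chart_inv c)"

definition charts_at :: "('a, 'e) manifold \<Rightarrow> 'a \<Rightarrow> ('a, 'e) chart set" where
  "charts_at M p = {c \<in> atlas M. p \<in> fst c}"

definition smooth_map ::
  "('a, 'e::euclidean_space) manifold \<Rightarrow> ('b, 'f::euclidean_space) manifold \<Rightarrow> ('a \<Rightarrow> 'b) \<Rightarrow> bool"
where
  "smooth_map M N f \<longleftrightarrow>
     continuous_map (mtopology M) (mtopology N) f \<and>
     (\<forall>c\<in>atlas M. \<forall>d\<in>atlas N.
        smooth_on (snd c ` (fst c \<inter> f -` fst d)) (snd d \<circ> f \<circ> chart_inv c))"

definition product_manifold ::
  "('a, 'e) manifold \<Rightarrow> ('b, 'f) manifold \<Rightarrow> ('a \<times> 'b, 'e \<times> 'f) manifold"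
where
  "product_manifold M N =
     \<lparr>mtopology = prod_topology (mtopology M) (mtopology N),
      atlas = {(fst c \<times> fst d, map_prod (snd c) (snd d)) | c d. c \<in> atlas M \<and> d \<in> atlas N}\<rparr>"

definition euclidean_manifold :: "('e::euclidean_space, 'e) manifold" where
  "euclidean_manifold = \<lparr>mtopology = euclidean, atlas = {(UNIV, id)}\<rparr>"

definition smooth_functions :: "('a, 'e::euclidean_space) manifold \<Rightarrow> ('a \<Rightarrow> real) set" where
  "smooth_functions M = {f. smooth_map M euclidean_manifold f}"


section \<open>Tangent vectors and the tangent bundle\<close>

text \<open>
  A tangent vector at \<open>p\<close> is the base point \<open>p\<close> together with a coordinate vector for every
  chart around \<open>p\<close>, transforming under a change of charts by the derivative of the transition
  map. Being 0 on charts not containing \<open>p\<close> makes the representation unique.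
\<close>

type_synonym ('a, 'e) tangent_vector = "'a \<times> (('a, 'e) chart \<Rightarrow> 'e)"

definition tangent_space ::
  "('a, 'e::euclidean_space) manifold \<Rightarrow> 'a \<Rightarrow> ('a, 'e) tangent_vector set"
where
  "tangent_space M p =
     {(p, w) | w.
        (\<forall>c. c \<notin> charts_at M p \<longrightarrow> w c = 0) \<and>
        (\<forall>c\<in>charts_at M p. \<forall>d\<in>charts_at M p.
           w d = frechet_derivative (snd d \<circ> chart_inv c) (at (snd c p)) (w c))}"

definition zero_tangent :: "'a \<Rightarrow> ('a, 'e::euclidean_space) tangent_vector" where
  "zero_tangent p = (p, \<lambda>_. 0)"

text \<open>
  The natural charts of the tangent bundle are \<open>t \<mapsto> (\<phi> p, w \<phi>)\<close> for \<open>t = (p, w)\<close> with \<open>p\<close> in the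
  domain of \<open>\<phi>\<close>; its topology is the one generated by the preimages of open sets under them.
\<close>

definition tangent_chart ::
  "('a, 'e::euclidean_space) manifold \<Rightarrow> ('a, 'e) chart \<Rightarrow> (('a, 'e) tangent_vector, 'e \<times> 'e) chart"
where
  "tangent_chart M c = ((\<Union>p\<in>fst c. tangent_space M p), \<lambda>t. (snd c (fst t), snd t c))"

definition tangent_bundle ::
  "('a, 'e::euclidean_space) manifold \<Rightarrow> (('a, 'e) tangent_vector, 'e \<times> 'e) manifold"
where
  "tangent_bundle M =
     \<lparr>mtopology = topology_generated_by
        {{t \<in> fst (tangent_chart M c). snd (tangent_chart M c) t \<in> W} | c W. c \<in> atlas M \<and> open W},
      atlas = tangent_chart M ` atlas M\<rparr>"

text \<open>
  The derivative of \<open>f\<close> applied to a tangent vector \<open>t\<close>, computed in an arbitrarily chosen chart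
  around its base point; by the chain rule the result does not depend on that choice.
\<close>

definition chart_at :: "('a, 'e) manifold \<Rightarrow> 'a \<Rightarrow> ('a, 'e) chart" where
  "chart_at M p = (SOME c. c \<in> charts_at M p)"

definition tangent_map ::
  "('a, 'e::euclidean_space) manifold \<Rightarrow> ('b, 'f::euclidean_space) manifold \<Rightarrow> ('a \<Rightarrow> 'b) \<Rightarrow>
   ('a, 'e) tangent_vector \<Rightarrow> ('b, 'f) tangent_vector"
where
  "tangent_map M N f t =
     (let p = fst t; c = chart_at M p in
      (f p, \<lambda>d. if d \<in> charts_at N (f p)
                then frechet_derivative (snd d \<circ> f \<circ> chart_inv c) (at (snd c p)) (snd t c)
                else 0))"


section \<open>Vector fields\<close>

definition smooth_vector_field ::
  "('a, 'e::euclidean_space) manifold \<Rightarrow> ('a \<Rightarrow> ('a, 'e) tangent_vector) \<Rightarrow> bool"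
where
  "smooth_vector_field M X \<longleftrightarrow>
     (\<forall>p\<in>points M. X p \<in> tangent_space M p) \<and> smooth_map M (tangent_bundle M) X"

text \<open>
  The derivative of a real-valued function along a tangent vector, and a vector field as an
  operator on functions.
\<close>

definition tangent_apply ::
  "('a, 'e::euclidean_space) manifold \<Rightarrow> ('a, 'e) tangent_vector \<Rightarrow> ('a \<Rightarrow> real) \<Rightarrow> real"
where
  "tangent_apply M t f =
     (let p = fst t; c = chart_at M p in
      frechet_derivative (f \<circ> chart_inv c) (at (snd c p)) (snd t c))"

definition vector_field_operator ::
  "('a, 'e::euclidean_space) manifold \<Rightarrow> ('a \<Rightarrow> ('a, 'e) tangent_vector) \<Rightarrow>
   ('a \<Rightarrow> real) \<Rightarrow> 'a \<Rightarrow> real"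
where
  "vector_field_operator M X f = (\<lambda>p. tangent_apply M (X p) f)"

definition pullback :: "('a \<Rightarrow> 'b) \<Rightarrow> ('b \<Rightarrow> 'c) \<Rightarrow> 'a \<Rightarrow> 'c" where
  "pullback l f = f \<circ> l"


section \<open>Lie semiheaps\<close>

locale lie_semiheap = smooth_manifold S
  for S :: "('a, 'e::euclidean_space) manifold" +
  fixes \<mu> :: "'a \<times> 'a \<times> 'a \<Rightarrow> 'a"
  assumes smooth_product: "smooth_map (product_manifold S (product_manifold S S)) S \<mu>"
    and para_assoc_left:
      "\<lbrakk>x1 \<in> points S; x2 \<in> points S; x3 \<in> points S; x4 \<in> points S; x5 \<in> points S\<rbrakk> \<Longrightarrow>
       \<mu> (\<mu> (x1, x2, x3), x4, x5) = \<mu> (x1, \<mu> (x4, x3, x2), x5)"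
    and para_assoc_right:
      "\<lbrakk>x1 \<in> points S; x2 \<in> points S; x3 \<in> points S; x4 \<in> points S; x5 \<in> points S\<rbrakk> \<Longrightarrow>
       \<mu> (x1, \<mu> (x4, x3, x2), x5) = \<mu> (x1, x2, \<mu> (x3, x4, x5))"

locale biunital_lie_semiheap = lie_semiheap S \<mu>
  for S :: "('a, 'e::euclidean_space) manifold" and \<mu> :: "'a \<times> 'a \<times> 'a \<Rightarrow> 'a" +
  fixes x0 :: 'a
  assumes basepoint: "x0 \<in> points S"
    and right_unit: "x \<in> points S \<Longrightarrow> \<mu> (x, x0, x0) = x"
    and left_unit: "x \<in> points S \<Longrightarrow> \<mu> (x0, x0, x) = x"

definition left_translation :: "('a \<times> 'a \<times> 'a \<Rightarrow> 'a) \<Rightarrow> 'a \<Rightarrow> 'a \<Rightarrow> 'a \<Rightarrow> 'a" where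
  "left_translation \<mu> x y = (\<lambda>z. \<mu> (x, y, z))"

definition left_translations ::
  "('a, 'e) manifold \<Rightarrow> ('a \<times> 'a \<times> 'a \<Rightarrow> 'a) \<Rightarrow> ('a \<Rightarrow> 'a) set"
where
  "left_translations S \<mu> = {left_translation \<mu> x y | x y. x \<in> points S \<and> y \<in> points S}"

text \<open>Operators on smooth functions are compared on the points of the manifold only.\<close>

definition left_invariant ::
  "('a, 'e::euclidean_space) manifold \<Rightarrow> ('a \<times> 'a \<times> 'a \<Rightarrow> 'a) \<Rightarrow>
   ('a \<Rightarrow> ('a, 'e) tangent_vector) \<Rightarrow> bool"
where
  "left_invariant S \<mu> X \<longleftrightarrow>
     (\<forall>l\<in>left_translations S \<mu>. \<forall>f\<in>smooth_functions S. \<forall>z\<in>points S.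
        (pullback l \<circ> vector_field_operator S X) f z =
        (vector_field_operator S X \<circ> pullback l) f z)"

end

theory Submission
  imports Defs
begin

text \<open>
  In coordinates, \<open>V\<close> is a partial derivative of the smooth map \<open>\<mu>\<close> with respect to its third
  argument, evaluated at fixed second and third arguments, and hence smooth in the first one.
  Left invariance is the chain rule applied to
  \<open>L\<^bsub>xy\<^esub> \<circ> L\<^bsub>z x0\<^esub> = L\<^bsub>[x,y,z] x0\<^esub>\<close>, an instance of para-associativity.
\<close>

section \<open>Functions of class \<open>C^k\<close>\<close>

text \<open>Having a given derivative at \<open>x\<close> is a local property, so both sides choose
  from the same set of derivatives; this also covers points where that set is empty.\<close>

lemma frechet_derivative_cong_open:
  assumes "open U" "x \<in> U" "\<And>y. y \<in> U \<Longrightarrow> f y = g y"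
  shows "frechet_derivative f (at x) = frechet_derivative g (at x)"
proof -
  have "(f has_derivative D) (at x) \<longleftrightarrow> (g has_derivative D) (at x)" for D
    using assms by (metis has_derivative_transform_within_open)
  then show ?thesis
    by (simp add: frechet_derivative_def)
qed

lemma differentiable_cong_open:
  assumes "f differentiable (at x)" "open U" "x \<in> U" "\<And>y. y \<in> U \<Longrightarrow> f y = g y"
  shows "g differentiable (at x)"
  using assms unfolding differentiable_def by (metis has_derivative_transform_within_open)

text \<open>Derivative formulas hold only at points of \<open>U\<close>, while the recursion in
  \<open>Ck_on\<close> speaks of functions on the whole space; this lemma lets such a formula stand
  in for \<open>frechet_derivative\<close>. The induction varies \<open>f\<close> and
  \<open>g\<close> because each step passes to directional derivatives.\<close>

lemma Ck_on_cong:
  assumes "open U" "\<And>x. x \<in> U \<Longrightarrow> f x = g x" "Ck_on k U f"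
  shows "Ck_on k U g"
  using assms(2,3)
proof (induction k arbitrary: f g)
  case 0
  then show ?case
    using continuous_on_cong by force
next
  case (Suc k)
  have "g differentiable (at x)" if "x \<in> U" for x
    using Suc.prems that differentiable_cong_open[OF _ assms(1) that] by auto
  moreover have "Ck_on k U (\<lambda>x. frechet_derivative g (at x) h)" for h
  proof (rule Suc.IH)
    show "Ck_on k U (\<lambda>x. frechet_derivative f (at x) h)"
      using Suc.prems by simp
    show "frechet_derivative f (at x) h = frechet_derivative g (at x) h" if "x \<in> U" for x
      using frechet_derivative_cong_open[OF assms(1) that] Suc.prems by metis
  qed
  ultimately show ?case
    by simp
qed

lemma smooth_on_cong:
  assumes "open U" "\<And>x. x \<in> U \<Longrightarrow> f x = g x" "smooth_on U f"
  shows "smooth_on U g"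
  using assms Ck_on_cong unfolding smooth_on_def by blast

lemma Ck_on_Pair:
  assumes "open U" "Ck_on k U f" "Ck_on k U g"
  shows "Ck_on k U (\<lambda>x. (f x, g x))"
  using assms(2,3)
proof (induction k arbitrary: f g)
  case 0
  then show ?case
    by (simp add: continuous_on_Pair)
next
  case (Suc k)
  have der: "((\<lambda>x. (f x, g x)) has_derivative
      (\<lambda>h. (frechet_derivative f (at x) h, frechet_derivative g (at x) h))) (at x)"
    if "x \<in> U" for x
    using Suc.prems that by (intro has_derivative_Pair) (auto simp: frechet_derivative_works[symmetric])
  have "(\<lambda>x. (f x, g x)) differentiable (at x)" if "x \<in> U" for x
    using der[OF that] differentiable_def by blast
  moreover have "Ck_on k U (\<lambda>x. frechet_derivative (\<lambda>x. (f x, g x)) (at x) h)" for h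
  proof (rule Ck_on_cong[OF assms(1)])
    show "Ck_on k U (\<lambda>x. (frechet_derivative f (at x) h, frechet_derivative g (at x) h))"
      using Suc by simp
    show "(frechet_derivative f (at x) h, frechet_derivative g (at x) h) =
        frechet_derivative (\<lambda>x. (f x, g x)) (at x) h" if "x \<in> U" for x
      using frechet_derivative_at[OF der[OF that]] by metis
  qed
  ultimately show ?case
    by simp
qed

lemma affine_compose_has_derivative:
  assumes "bounded_linear A" "f differentiable (at (a + A x))"
  shows "((\<lambda>y. f (a + A y)) has_derivative
    (\<lambda>h. frechet_derivative f (at (a + A x)) (A h))) (at x)"
proof -
  have "((\<lambda>y. a + A y) has_derivative A) (at x)"
    using bounded_linear_imp_has_derivative[OF assms(1)] by (auto intro!: derivative_eq_intros)
  from has_derivative_compose[OF this assms(2)[unfolded frechet_derivative_works]]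
  show ?thesis .
qed

text \<open>The inner map has the constant linear part \<open>A\<close>, so the derivative of the
  composite in direction \<open>h\<close> is the derivative of \<open>f\<close> in the fixed
  direction \<open>A h\<close>, composed with the same affine map. The induction thus closes without
  a product rule. Freezing arguments of the ternary product in coordinates is an affine inner map of
  this kind.\<close>

lemma Ck_on_compose_affine:
  fixes A :: "'d::euclidean_space \<Rightarrow> 'e::euclidean_space" and f :: "'e \<Rightarrow> 'f::euclidean_space"
  assumes "bounded_linear A" "open V" "\<And>y. y \<in> V \<Longrightarrow> a + A y \<in> U" "Ck_on k U f"
  shows "Ck_on k V (\<lambda>y. f (a + A y))"
  using assms(4)
proof (induction k arbitrary: f)
  case 0
  have "continuous_on V (\<lambda>y. a + A y)"
    using assms(1) by (intro continuous_intros linear_continuous_on)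
  with 0 show ?case
    using assms(3) by (auto intro: continuous_on_compose2)
next
  case (Suc k)
  have der: "((\<lambda>y. f (a + A y)) has_derivative
      (\<lambda>h. frechet_derivative f (at (a + A x)) (A h))) (at x)" if "x \<in> V" for x
    using Suc.prems assms(3)[OF that] by (intro affine_compose_has_derivative assms) auto
  have "(\<lambda>y. f (a + A y)) differentiable (at x)" if "x \<in> V" for x
    using der[OF that] differentiable_def by blast
  moreover have "Ck_on k V (\<lambda>x. frechet_derivative (\<lambda>y. f (a + A y)) (at x) h)" for h
  proof (rule Ck_on_cong[OF assms(2)])
    show "Ck_on k V (\<lambda>x. frechet_derivative f (at (a + A x)) (A h))"
      using Suc.IH[of "\<lambda>x. frechet_derivative f (at x) (A h)"] Suc.prems by simp
    show "frechet_derivative f (at (a + A x)) (A h) =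
        frechet_derivative (\<lambda>y. f (a + A y)) (at x) h" if "x \<in> V" for x
      using frechet_derivative_at[OF der[OF that]] by metis
  qed
  ultimately show ?case
    by simp
qed

lemma smooth_on_compose_affine:
  fixes A :: "'d::euclidean_space \<Rightarrow> 'e::euclidean_space" and f :: "'e \<Rightarrow> 'f::euclidean_space"
  assumes "bounded_linear A" "open V" "\<And>y. y \<in> V \<Longrightarrow> a + A y \<in> U" "smooth_on U f"
  shows "smooth_on V (\<lambda>y. f (a + A y))"
  using assms Ck_on_compose_affine unfolding smooth_on_def by blast

lemma smooth_on_Pair:
  assumes "open U" "smooth_on U f" "smooth_on U g"
  shows "smooth_on U (\<lambda>x. (f x, g x))"
  using assms Ck_on_Pair unfolding smooth_on_def by blast

lemma smooth_on_imp_differentiable: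
  assumes "smooth_on U f" "x \<in> U"
  shows "f differentiable (at x)"
proof -
  have "Ck_on (Suc 0) U f"
    using assms(1) unfolding smooth_on_def by blast
  with assms(2) show ?thesis
    by simp
qed

lemma smooth_on_imp_continuous_on: "smooth_on U f \<Longrightarrow> continuous_on U f"
  unfolding smooth_on_def by (metis Ck_on.simps(1))

lemma smooth_on_directional_derivative:
  assumes "smooth_on U f"
  shows "smooth_on U (\<lambda>x. frechet_derivative f (at x) h)"
  using assms unfolding smooth_on_def by (metis Ck_on.simps(2))


section \<open>Charts\<close>

context smooth_manifold
begin

lemma chart_subset: "c \<in> atlas M \<Longrightarrow> fst c \<subseteq> points M"
  using covers by blast

lemma topspace_chart:
  "c \<in> atlas M \<Longrightarrow> topspace (subtopology (mtopology M) (fst c)) = fst c"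
  using chart_subset by (simp add: Int_absorb1)

lemma chart_inj: "c \<in> atlas M \<Longrightarrow> inj_on (snd c) (fst c)"
  using homeomorphic_imp_injective_map[OF chart_homeomorphic] topspace_chart by metis

lemma chart_inv_chart:
  "c \<in> atlas M \<Longrightarrow> x \<in> fst c \<Longrightarrow> chart_inv c (snd c x) = x"
  using chart_inj by (rule inv_into_f_f)

lemma open_chart_image:
  assumes "c \<in> atlas M" "openin (mtopology M) U"
  shows "open (snd c ` (fst c \<inter> U))"
proof -
  have "openin (subtopology (mtopology M) (fst c)) (fst c \<inter> U)"
    using assms(2) by (simp add: openin_subtopology_Int2)
  then have "openin (top_of_set (snd c ` fst c)) (snd c ` (fst c \<inter> U))"
    using homeomorphic_imp_open_map[OF chart_homeomorphic[OF assms(1)]]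
    unfolding open_map_def by blast
  then show ?thesis
    using chart_image_open[OF assms(1)] openin_open_eq by blast
qed

lemma openin_chart_preimage:
  assumes "c \<in> atlas M" "open W"
  shows "openin (mtopology M) {x \<in> fst c. snd c x \<in> W}"
proof -
  have "continuous_map (subtopology (mtopology M) (fst c)) (top_of_set (snd c ` fst c)) (snd c)"
    by (rule homeomorphic_imp_continuous_map[OF chart_homeomorphic[OF assms(1)]])
  then have "continuous_map (subtopology (mtopology M) (fst c)) euclidean (snd c)"
    by (rule continuous_map_into_fulltopology)
  then have "openin (subtopology (mtopology M) (fst c))
      {x \<in> topspace (subtopology (mtopology M) (fst c)). snd c x \<in> W}"
    using assms(2) by (simp add: continuous_map_def)
  then show ?thesis
    unfolding topspace_chart[OF assms(1)] openin_open_subtopology[OF chart_open[OF assms(1)]]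
    by (rule conjunct1)
qed

text \<open>Coordinate expressions of a continuous map live on such sets, and smoothness and local
  equality of derivatives are handled on open sets.\<close>

lemma open_chart_image_preimage:
  assumes "continuous_map (mtopology M) T f" "c \<in> atlas M" "openin T U"
  shows "open (snd c ` (fst c \<inter> f -` U))"
proof -
  have "openin (mtopology M) {x \<in> points M. f x \<in> U}"
    using assms by (simp add: continuous_map_def)
  from open_chart_image[OF assms(2) this]
  have "open (snd c ` (fst c \<inter> {x \<in> points M. f x \<in> U}))" .
  moreover have "fst c \<inter> {x \<in> points M. f x \<in> U} = fst c \<inter> f -` U"
    using chart_subset[OF assms(2)] by blast
  ultimately show ?thesis
    by simp
qed

text \<open>Near \<open>snd c x\<close> a coordinate expression evaluates its function only on
  \<open>fst c\<close>, a part of the carrier. So the semiheap laws, which hold on the carrier, may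
  be used under a derivative.\<close>

lemma frechet_derivative_chart_cong:
  assumes "c \<in> atlas M" "x \<in> fst c" "\<And>y. y \<in> points M \<Longrightarrow> f y = g y"
  shows "frechet_derivative (f \<circ> chart_inv c) (at (snd c x)) =
    frechet_derivative (g \<circ> chart_inv c) (at (snd c x))"
proof (rule frechet_derivative_cong_open[OF chart_image_open[OF assms(1)]])
  show "(f \<circ> chart_inv c) y = (g \<circ> chart_inv c) y" if "y \<in> snd c ` fst c" for y
    using that assms chart_subset[OF assms(1)] chart_inv_chart[OF assms(1)] by force
qed (use assms in simp)

lemma chart_at_in_charts_at:
  assumes "x \<in> points M"
  shows "chart_at M x \<in> charts_at M x"
proof -
  obtain c where "c \<in> atlas M" "x \<in> fst c"
    using assms covers by blast
  then have "c \<in> charts_at M x"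
    by (simp add: charts_at_def)
  then show ?thesis
    unfolding chart_at_def by (rule someI)
qed

lemma chart_at:
  assumes "x \<in> points M"
  shows "chart_at M x \<in> atlas M" "x \<in> fst (chart_at M x)"
  using chart_at_in_charts_at[OF assms] by (auto simp: charts_at_def)

lemma transition_differentiable:
  assumes "c \<in> atlas M" "d \<in> atlas M" "x \<in> fst c" "x \<in> fst d"
  shows "(snd d \<circ> chart_inv c) differentiable (at (snd c x))"
  using charts_compatible[OF assms(1,2)] assms by (blast intro: smooth_on_imp_differentiable)

end

section \<open>Smooth maps and the chain rule in charts\<close>

lemma product_manifold_atlasI:
  "c \<in> atlas M \<Longrightarrow> d \<in> atlas N \<Longrightarrow>
    (fst c \<times> fst d, map_prod (snd c) (snd d)) \<in> atlas (product_manifold M N)"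
  by (simp add: product_manifold_def del: split_paired_Ex) blast

lemma smooth_mapD:
  "smooth_map M N f \<Longrightarrow> c \<in> atlas M \<Longrightarrow> d \<in> atlas N \<Longrightarrow>
    smooth_on (snd c ` (fst c \<inter> f -` fst d)) (snd d \<circ> f \<circ> chart_inv c)"
  by (simp add: smooth_map_def)

lemma smooth_map_differentiable:
  assumes "smooth_map M N f" "c \<in> atlas M" "d \<in> atlas N" "x \<in> fst c" "f x \<in> fst d"
  shows "(snd d \<circ> f \<circ> chart_inv c) differentiable (at (snd c x))"
  using smooth_on_imp_differentiable[OF smooth_mapD[OF assms(1-3)]] assms(4,5) by blast

lemma smooth_functions_differentiable:
  assumes "f \<in> smooth_functions M" "c \<in> atlas M" "x \<in> fst c"
  shows "(f \<circ> chart_inv c) differentiable (at (snd c x))"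
  \<comment> \<open>The single chart \<open>(UNIV, id)\<close> of the target leaves
    \<open>f \<circ> chart_inv c\<close> as the coordinate expression.\<close>
  using smooth_map_differentiable[of M euclidean_manifold f c "(UNIV, id)" x] assms
  by (simp add: smooth_functions_def euclidean_manifold_def)

text \<open>On the open set where \<open>f\<close> lands in the domain of \<open>d\<close>, the maps
  \<open>chart_inv d\<close> and \<open>snd d\<close> cancel, and the ordinary chain rule applies to
  the two coordinate expressions. With \<open>g\<close> left general, it can be a coordinate map as
  well as a smooth real function.\<close>

lemma chart_chain_rule:
  assumes M: "smooth_manifold M" and N: "smooth_manifold N"
    and f: "smooth_map M N f"
    and c: "c \<in> atlas M" "x \<in> fst c" and d: "d \<in> atlas N" "f x \<in> fst d"
    and g: "(g \<circ> chart_inv d) differentiable (at (snd d (f x)))"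
  shows "(g \<circ> f \<circ> chart_inv c) differentiable (at (snd c x))" (is ?diff)
    and "frechet_derivative (g \<circ> f \<circ> chart_inv c) (at (snd c x)) h =
      frechet_derivative (g \<circ> chart_inv d) (at (snd d (f x)))
        (frechet_derivative (snd d \<circ> f \<circ> chart_inv c) (at (snd c x)) h)" (is ?chain)
proof -
  interpret M: smooth_manifold M by fact
  interpret N: smooth_manifold N by fact
  let ?U = "snd c ` (fst c \<inter> f -` fst d)"
  have U: "open ?U"
    using f N.chart_open[OF d(1)] M.open_chart_image_preimage[OF _ c(1)]
    unfolding smooth_map_def by blast
  have inv: "chart_inv c (snd c x) = x"
    using M.chart_inv_chart[OF c] .
  have "((g \<circ> chart_inv d) \<circ> (snd d \<circ> f \<circ> chart_inv c) has_derivative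
      frechet_derivative (g \<circ> chart_inv d) (at (snd d (f x))) \<circ>
      frechet_derivative (snd d \<circ> f \<circ> chart_inv c) (at (snd c x))) (at (snd c x))"
    using smooth_map_differentiable[OF f c(1) d(1) c(2) d(2)] g
    by (intro diff_chain_at) (simp_all add: frechet_derivative_works inv)
  then have "((g \<circ> f \<circ> chart_inv c) has_derivative
      frechet_derivative (g \<circ> chart_inv d) (at (snd d (f x))) \<circ>
      frechet_derivative (snd d \<circ> f \<circ> chart_inv c) (at (snd c x))) (at (snd c x))"
  proof (rule has_derivative_transform_within_open[OF _ U])
    show "snd c x \<in> ?U"
      using c d by blast
    show "((g \<circ> chart_inv d) \<circ> (snd d \<circ> f \<circ> chart_inv c)) y = (g \<circ> f \<circ> chart_inv c) y"
      if "y \<in> ?U" for y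
      using that by (auto simp: M.chart_inv_chart[OF c(1)] N.chart_inv_chart[OF d(1)])
  qed
  then show ?diff ?chain
    by (auto simp: differentiable_def frechet_derivative_at[symmetric])
qed


section \<open>Components of tangent vectors\<close>

lemma tangent_base: "v \<in> tangent_space M p \<Longrightarrow> fst v = p"
  by (auto simp: tangent_space_def)

lemma tangent_outside: "v \<in> tangent_space M p \<Longrightarrow> c \<notin> charts_at M p \<Longrightarrow> snd v c = 0"
  by (cases c) (auto simp: tangent_space_def)

lemma tangent_transform:
  assumes "v \<in> tangent_space M p" "c \<in> charts_at M p" "d \<in> charts_at M p"
  shows "snd v d = frechet_derivative (snd d \<circ> chart_inv c) (at (snd c p)) (snd v c)"
proof -
  obtain w where "v = (p, w)"
    and "\<forall>c\<in>charts_at M p. \<forall>d\<in>charts_at M p.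
      w d = frechet_derivative (snd d \<circ> chart_inv c) (at (snd c p)) (w c)"
    using assms(1) unfolding tangent_space_def by blast
  with assms(2,3) show ?thesis
    by (metis snd_conv)
qed


section \<open>Left translations\<close>

context lie_semiheap
begin

lemma continuous_product:
  "continuous_map (prod_topology (mtopology S) (prod_topology (mtopology S) (mtopology S)))
     (mtopology S) \<mu>"
  using smooth_product by (simp add: smooth_map_def product_manifold_def)

lemma product_closed:
  "x \<in> points S \<Longrightarrow> y \<in> points S \<Longrightarrow> z \<in> points S \<Longrightarrow> \<mu> (x, y, z) \<in> points S"
  using continuous_product by (auto simp: continuous_map_def)

text \<open>The nesting to the right mirrors
  \<open>product_manifold S (product_manifold S S)\<close>, so for charts of \<open>S\<close> this
  is a member of that atlas.\<close>

definition triple_chart ::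
  "('a, 'e) chart \<Rightarrow> ('a, 'e) chart \<Rightarrow> ('a, 'e) chart \<Rightarrow> ('a \<times> 'a \<times> 'a, 'e \<times> 'e \<times> 'e) chart"
where
  "triple_chart c1 c2 c3 =
     (fst c1 \<times> fst c2 \<times> fst c3, map_prod (snd c1) (map_prod (snd c2) (snd c3)))"

definition product_domain ::
  "('a, 'e) chart \<Rightarrow> ('a, 'e) chart \<Rightarrow> ('a, 'e) chart \<Rightarrow> ('a, 'e) chart \<Rightarrow> ('e \<times> 'e \<times> 'e) set"
where
  "product_domain c1 c2 c3 d =
     snd (triple_chart c1 c2 c3) ` (fst (triple_chart c1 c2 c3) \<inter> \<mu> -` fst d)"

definition product_in_charts ::
  "('a, 'e) chart \<Rightarrow> ('a, 'e) chart \<Rightarrow> ('a, 'e) chart \<Rightarrow> ('a, 'e) chart \<Rightarrow> 'e \<times> 'e \<times> 'e \<Rightarrow> 'e"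
where
  "product_in_charts c1 c2 c3 d = snd d \<circ> \<mu> \<circ> chart_inv (triple_chart c1 c2 c3)"

lemma product_domainI:
  assumes "x \<in> fst c1" "y \<in> fst c2" "z \<in> fst c3" "\<mu> (x, y, z) \<in> fst d"
  shows "(snd c1 x, snd c2 y, snd c3 z) \<in> product_domain c1 c2 c3 d"
  unfolding product_domain_def
  by (rule image_eqI[where x = "(x, y, z)"]) (use assms in \<open>simp_all add: triple_chart_def\<close>)

lemma product_in_charts_chart:
  assumes "c1 \<in> atlas S" "c2 \<in> atlas S" "c3 \<in> atlas S"
    and "x \<in> fst c1" "y \<in> fst c2" "z \<in> fst c3"
  shows "product_in_charts c1 c2 c3 d (snd c1 x, snd c2 y, snd c3 z) = snd d (\<mu> (x, y, z))"
proof -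
  have "inj_on (snd (triple_chart c1 c2 c3)) (fst (triple_chart c1 c2 c3))"
    using assms(1-3) by (auto simp: triple_chart_def intro!: map_prod_inj_on chart_inj)
  from inv_into_f_f[OF this, of "(x, y, z)"]
  have "chart_inv (triple_chart c1 c2 c3) (snd c1 x, snd c2 y, snd c3 z) = (x, y, z)"
    using assms(4-6) by (simp add: triple_chart_def)
  then show ?thesis
    by (simp add: product_in_charts_def)
qed

lemma smooth_on_product_in_charts:
  assumes "c1 \<in> atlas S" "c2 \<in> atlas S" "c3 \<in> atlas S" "d \<in> atlas S"
  shows "smooth_on (product_domain c1 c2 c3 d) (product_in_charts c1 c2 c3 d)"
proof -
  have "triple_chart c1 c2 c3 \<in> atlas (product_manifold S (product_manifold S S))"
    using product_manifold_atlasI[OF assms(1) product_manifold_atlasI[OF assms(2,3)]]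
    by (simp add: triple_chart_def)
  from smooth_mapD[OF smooth_product this assms(4)] show ?thesis
    unfolding product_domain_def product_in_charts_def .
qed

section \<open>Translations and their derivatives in coordinates\<close>

lemma continuous_left_translation:
  assumes "x \<in> points S" "y \<in> points S"
  shows "continuous_map (mtopology S) (mtopology S) (left_translation \<mu> x y)"
proof -
  have "continuous_map (mtopology S)
      (prod_topology (mtopology S) (prod_topology (mtopology S) (mtopology S))) (\<lambda>z. (x, y, z))"
    using assms by (intro continuous_map_pairedI) auto
  from continuous_map_compose[OF this continuous_product] show ?thesis
    by (simp add: left_translation_def o_def)
qed

lemma continuous_right_translation:
  assumes "y \<in> points S" "z \<in> points S"
  shows "continuous_map (mtopology S) (mtopology S) (\<lambda>x. \<mu> (x, y, z))"
proof -
  have "continuous_map (mtopology S)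
      (prod_topology (mtopology S) (prod_topology (mtopology S) (mtopology S))) (\<lambda>x. (x, y, z))"
    using assms by (intro continuous_map_pairedI) auto
  from continuous_map_compose[OF this continuous_product] show ?thesis
    by (simp add: o_def)
qed

lemma open_left_translation_domain:
  assumes "x \<in> points S" "y \<in> points S" "c \<in> atlas S" "d \<in> atlas S"
  shows "open (snd c ` (fst c \<inter> left_translation \<mu> x y -` fst d))"
  using assms by (intro open_chart_image_preimage[OF continuous_left_translation] chart_open)

text \<open>Freezing the first two arguments becomes, in coordinates, a slice of the domain of the
  product. The slice is written as a constant plus a linear embedding to match
  \<open>smooth_on_compose_affine\<close>.\<close>

lemma left_translation_in_charts:
  assumes "c1 \<in> atlas S" "c2 \<in> atlas S" "c3 \<in> atlas S" "x \<in> fst c1" "y \<in> fst c2"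
    and "e \<in> snd c3 ` (fst c3 \<inter> left_translation \<mu> x y -` fst d)"
  shows "product_in_charts c1 c2 c3 d ((snd c1 x, snd c2 y, 0) + (0, 0, e)) =
      (snd d \<circ> left_translation \<mu> x y \<circ> chart_inv c3) e"
    and "(snd c1 x, snd c2 y, 0) + (0, 0, e) \<in> product_domain c1 c2 c3 d"
  using assms
  by (auto simp: product_in_charts_chart chart_inv_chart left_translation_def product_domainI)

lemma smooth_left_translation:
  assumes "x \<in> points S" "y \<in> points S"
  shows "smooth_map S S (left_translation \<mu> x y)"
  unfolding smooth_map_def
proof (intro conjI ballI)
  show "continuous_map (mtopology S) (mtopology S) (left_translation \<mu> x y)"
    using assms by (rule continuous_left_translation)
next
  fix c d
  assume c: "c \<in> atlas S" and d: "d \<in> atlas S"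
  let ?V = "snd c ` (fst c \<inter> left_translation \<mu> x y -` fst d)"
  let ?G = "product_in_charts (chart_at S x) (chart_at S y) c d"
  let ?a = "(snd (chart_at S x) x, snd (chart_at S y) y, 0)"
  note charts = chart_at(1)[OF assms(1)] chart_at(1)[OF assms(2)]
    and translation = left_translation_in_charts[OF chart_at(1)[OF assms(1)]
      chart_at(1)[OF assms(2)] c chart_at(2)[OF assms(1)] chart_at(2)[OF assms(2)]]
  have V: "open ?V"
    using assms c d by (rule open_left_translation_domain)
  have "smooth_on ?V (\<lambda>e. ?G (?a + (0, 0, e)))"
  proof (rule smooth_on_compose_affine[where A = "\<lambda>e. (0, 0, e)", OF _ V])
    show "bounded_linear (\<lambda>e::'e. (0::'e, 0::'e, e))"
      by (intro bounded_linear_intros)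
    show "smooth_on (product_domain (chart_at S x) (chart_at S y) c d) ?G"
      using charts c d by (rule smooth_on_product_in_charts)
  qed (rule translation(2))
  with V translation(1) show "smooth_on ?V (snd d \<circ> left_translation \<mu> x y \<circ> chart_inv c)"
    by (rule smooth_on_cong)
qed

text \<open>Here the translating point varies, with coordinate \<open>e\<close>, while
  \<open>z\<close> and the direction \<open>w\<close> stay fixed. The derivative of the translation
  is the derivative of the coordinate product in direction \<open>(0, 0, w)\<close>, a smooth
  function of all three arguments, restricted to the slice through the coordinates of
  \<open>y\<close> and \<open>z\<close>.\<close>

lemma smooth_on_left_translation_derivative:
  assumes c: "c \<in> atlas S" and d: "d \<in> atlas S" and c3: "c3 \<in> atlas S"
    and y: "y \<in> points S" and z: "z \<in> fst c3"
  shows "smooth_on (snd c ` (fst c \<inter> (\<lambda>x. \<mu> (x, y, z)) -` fst d))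
    (\<lambda>e. frechet_derivative (snd d \<circ> left_translation \<mu> (chart_inv c e) y \<circ> chart_inv c3)
      (at (snd c3 z)) w)"
proof -
  let ?V = "snd c ` (fst c \<inter> (\<lambda>x. \<mu> (x, y, z)) -` fst d)"
  define c2 where "c2 = chart_at S y"
  have c2: "c2 \<in> atlas S" "y \<in> fst c2"
    using chart_at[OF y] by (simp_all add: c2_def)
  have z': "z \<in> points S"
    using chart_subset[OF c3] z by blast
  let ?G = "product_in_charts c c2 c3 d" and ?W = "product_domain c c2 c3 d"
  have G: "smooth_on ?W ?G"
    using c c2(1) c3 d by (rule smooth_on_product_in_charts)
  have V: "open ?V"
    using chart_open[OF d] by (rule open_chart_image_preimage[OF continuous_right_translation[OF y z'] c])
  have lin1: "bounded_linear (\<lambda>e::'e. (e, 0::'e, 0::'e))"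
    and lin3: "bounded_linear (\<lambda>e::'e. (0::'e, 0::'e, e))"
    by (intro bounded_linear_intros)+
  \<comment> \<open>First differentiate in the third slot along a constant direction, then let only
    the first slot vary.\<close>
  have "smooth_on ?V (\<lambda>e. frechet_derivative ?G (at ((0, snd c2 y, snd c3 z) + (e, 0, 0))) (0, 0, w))"
    by (rule smooth_on_compose_affine[OF lin1 V _ smooth_on_directional_derivative[OF G]])
      (use c2 z in \<open>auto intro: product_domainI\<close>)
  then show ?thesis
  proof (rule smooth_on_cong[OF V, rotated])
    fix e
    assume "e \<in> ?V"
    then obtain x where x: "x \<in> fst c" "\<mu> (x, y, z) \<in> fst d" and e: "e = snd c x"
      by blast
    have x': "x \<in> points S"
      using chart_subset[OF c] x by blast
    let ?U = "snd c3 ` (fst c3 \<inter> left_translation \<mu> x y -` fst d)"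
    let ?a = "(snd c x, snd c2 y, 0)"
    \<comment> \<open>Now \<open>x\<close> is fixed and the third slot moves: the chain rule for the
      embedding of that slot sends the direction \<open>w\<close> to
      \<open>(0, 0, w)\<close>.\<close>
    have "?G differentiable (at (?a + (0, 0, snd c3 z)))"
      by (rule smooth_on_imp_differentiable[OF G]) (use x c2 z in \<open>simp add: product_domainI\<close>)
    from frechet_derivative_at[OF affine_compose_has_derivative[OF lin3 this]]
    have "frechet_derivative (\<lambda>e. ?G (?a + (0, 0, e))) (at (snd c3 z)) w =
        frechet_derivative ?G (at (snd c x, snd c2 y, snd c3 z)) (0, 0, w)"
      by (metis (no_types, lifting) add_Pair add.right_neutral add_0)
    \<comment> \<open>On the open neighbourhood \<open>?U\<close> of \<open>snd c3 z\<close>,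
      \<open>?G\<close> along this slice is the coordinate expression of the translation.\<close>
    moreover have "frechet_derivative (\<lambda>e. ?G (?a + (0, 0, e))) (at (snd c3 z)) =
        frechet_derivative (snd d \<circ> left_translation \<mu> x y \<circ> chart_inv c3) (at (snd c3 z))"
    proof (rule frechet_derivative_cong_open)
      show "open ?U"
        using x' y c3 d by (rule open_left_translation_domain)
      show "snd c3 z \<in> ?U"
        using z x by (simp add: left_translation_def)
      show "?G (?a + (0, 0, e)) = (snd d \<circ> left_translation \<mu> x y \<circ> chart_inv c3) e"
        if "e \<in> ?U" for e
        using c c2(1) c3 x(1) c2(2) that by (rule left_translation_in_charts)
    qed
    ultimately show "frechet_derivative ?G (at ((0, snd c2 y, snd c3 z) + (e, 0, 0))) (0, 0, w) =
        frechet_derivative (snd d \<circ> left_translation \<mu> (chart_inv c e) y \<circ> chart_inv c3)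
          (at (snd c3 z)) w"
      using e chart_inv_chart[OF c x(1)] by simp
  qed
qed

end


section \<open>Translating a tangent vector at the base point\<close>

context biunital_lie_semiheap
begin

text \<open>This is the map \<open>V\<close> of the theorem.\<close>

definition translated_field :: "('a, 'e) tangent_vector \<Rightarrow> 'a \<Rightarrow> ('a, 'e) tangent_vector" where
  "translated_field v x = tangent_map S S (left_translation \<mu> x x0) v"

text \<open>The right unit law is what makes the vector translated by \<open>x\<close> sit at
  \<open>x\<close>.\<close>

lemma left_translation_basepoint: "x \<in> points S \<Longrightarrow> left_translation \<mu> x x0 x0 = x"
  by (simp add: left_translation_def right_unit)

text \<open>The two para-associative laws, with \<open>x0\<close> as fourth argument, meet in the
  middle term \<open>\<mu> (x, \<mu> (x0, z, y), u)\<close>.\<close>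

lemma left_translation_comp:
  assumes "x \<in> points S" "y \<in> points S" "z \<in> points S" "u \<in> points S"
  shows "left_translation \<mu> x y (left_translation \<mu> z x0 u) =
    left_translation \<mu> (\<mu> (x, y, z)) x0 u"
  unfolding left_translation_def
  using para_assoc_left[OF assms(1-3) basepoint assms(4)]
    para_assoc_right[OF assms(1-3) basepoint assms(4)] by metis

context
  fixes v :: "('a, 'e) tangent_vector"
  assumes v: "v \<in> tangent_space S x0"
begin

text \<open>This is the chart in which \<open>tangent_map\<close> evaluates at \<open>x0\<close>;
  every coordinate formula for the field refers to it.\<close>

abbreviation base_chart :: "('a, 'e) chart" where
  "base_chart \<equiv> chart_at S x0"

lemma fst_translated_field: "x \<in> points S \<Longrightarrow> fst (translated_field v x) = x"
  using tangent_base[OF v]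
  by (simp add: translated_field_def tangent_map_def Let_def left_translation_basepoint)

lemma snd_translated_field:
  assumes "d \<in> atlas S" "x \<in> fst d"
  shows "snd (translated_field v x) d =
    frechet_derivative (snd d \<circ> left_translation \<mu> x x0 \<circ> chart_inv base_chart)
      (at (snd base_chart x0)) (snd v base_chart)"
proof -
  have "x \<in> points S"
    using chart_subset[OF assms(1)] assms(2) by blast
  then show ?thesis
    using assms by (simp add: translated_field_def tangent_map_def Let_def
        tangent_base[OF v] left_translation_basepoint charts_at_def)
qed

text \<open>The chain rule along \<open>left_translation \<mu> x x0\<close>, which sends
  \<open>x0\<close> to \<open>x\<close>, moves every differentiation at \<open>x\<close> back to
  \<open>x0\<close> and the given \<open>v\<close>. Taking \<open>g\<close> to be a coordinate map,
  a smooth function, or such a function composed with a translation yields the transformation law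
  and both sides of left invariance.\<close>

lemma chart_chain_rule_translated_field:
  assumes d: "d \<in> atlas S" "x \<in> fst d"
    and g: "(g \<circ> chart_inv d) differentiable (at (snd d x))"
  shows "frechet_derivative (g \<circ> chart_inv d) (at (snd d x)) (snd (translated_field v x) d) =
    frechet_derivative (g \<circ> left_translation \<mu> x x0 \<circ> chart_inv base_chart)
      (at (snd base_chart x0)) (snd v base_chart)"
proof -
  have x: "x \<in> points S"
    using chart_subset[OF d(1)] d(2) by blast
  have "frechet_derivative (g \<circ> left_translation \<mu> x x0 \<circ> chart_inv base_chart)
      (at (snd base_chart x0)) (snd v base_chart) =
    frechet_derivative (g \<circ> chart_inv d) (at (snd d (left_translation \<mu> x x0 x0)))
      (frechet_derivative (snd d \<circ> left_translation \<mu> x x0 \<circ> chart_inv base_chart)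
        (at (snd base_chart x0)) (snd v base_chart))"
    using d g x basepoint
    by (intro chart_chain_rule(2)[OF smooth_manifold_axioms smooth_manifold_axioms]
        smooth_left_translation chart_at)
      (simp_all add: left_translation_basepoint)
  then show ?thesis
    using snd_translated_field[OF d] x by (simp add: left_translation_basepoint)
qed

text \<open>The transformation law is the previous lemma for \<open>g = snd d\<close> in the chart
  \<open>c\<close>, its right side being the component in \<open>d\<close>. Off the charts around
  \<open>x\<close> the components vanish by the default value in \<open>tangent_map\<close>.\<close>

lemma translated_field_tangent:
  assumes x: "x \<in> points S"
  shows "translated_field v x \<in> tangent_space S x"
proof -
  have "snd (translated_field v x) d =
      frechet_derivative (snd d \<circ> chart_inv c) (at (snd c x)) (snd (translated_field v x) c)"
    if "c \<in> charts_at S x" "d \<in> charts_at S x" for c d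
    using that chart_chain_rule_translated_field[OF _ _ transition_differentiable, of c x d]
    by (simp add: charts_at_def snd_translated_field)
  moreover have "translated_field v x = (x, snd (translated_field v x))"
    using fst_translated_field[OF x] by (simp add: prod_eq_iff)
  moreover have "snd (translated_field v x) c = 0" if "c \<notin> charts_at S x" for c
    using that x tangent_base[OF v]
    by (simp add: translated_field_def tangent_map_def Let_def left_translation_basepoint)
  ultimately show ?thesis
    unfolding tangent_space_def by blast
qed

lemma tangent_apply_translated_field:
  assumes x: "x \<in> points S" and f: "f \<in> smooth_functions S"
  shows "tangent_apply S (translated_field v x) f =
    frechet_derivative (f \<circ> left_translation \<mu> x x0 \<circ> chart_inv base_chart)
      (at (snd base_chart x0)) (snd v base_chart)"
  using chart_chain_rule_translated_field[OF chart_at[OF x]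
      smooth_functions_differentiable[OF f chart_at[OF x]]]
  by (simp add: tangent_apply_def Let_def fst_translated_field[OF x])

section \<open>Smoothness of the field\<close>

text \<open>The first component is a transition map; the second is the derivative of a translation
  at \<open>x0\<close>, with the translating point moving.\<close>

lemma translated_field_in_charts:
  assumes c: "c \<in> atlas S" and d: "d \<in> atlas S"
  shows "smooth_on (snd c ` (fst c \<inter> fst d))
    (\<lambda>e. (snd d (chart_inv c e), snd (translated_field v (chart_inv c e)) d))"
proof (rule smooth_on_Pair)
  let ?U = "snd c ` (fst c \<inter> fst d)"
  show U: "open ?U"
    using c chart_open[OF d] by (rule open_chart_image)
  show "smooth_on ?U (\<lambda>e. snd d (chart_inv c e))"
    using charts_compatible[OF c d] by (simp add: o_def)
  \<comment> \<open>The smoothness domain for \<open>y = z = x0\<close> reduces to the chart overlap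
    by the right unit law.\<close>
  have "fst c \<inter> (\<lambda>x. \<mu> (x, x0, x0)) -` fst d = fst c \<inter> fst d"
    using chart_subset[OF c] right_unit by force
  then have "smooth_on ?U
      (\<lambda>e. frechet_derivative (snd d \<circ> left_translation \<mu> (chart_inv c e) x0 \<circ> chart_inv base_chart)
        (at (snd base_chart x0)) (snd v base_chart))"
    using smooth_on_left_translation_derivative[OF c d chart_at(1)[OF basepoint]
        basepoint chart_at(2)[OF basepoint], of "snd v base_chart"] by simp
  then show "smooth_on ?U (\<lambda>e. snd (translated_field v (chart_inv c e)) d)"
    by (rule smooth_on_cong[OF U, rotated])
      (auto simp: chart_inv_chart[OF c] snd_translated_field[OF d])
qed

text \<open>A tangent vector carries its base point, so fibres over different points are
  disjoint.\<close>

lemma translated_field_in_tangent_chart: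
  assumes "x \<in> points S"
  shows "translated_field v x \<in> fst (tangent_chart S d) \<longleftrightarrow> x \<in> fst d"
proof -
  have "translated_field v x \<in> tangent_space S p \<longleftrightarrow> p = x" for p
    using translated_field_tangent[OF assms] fst_translated_field[OF assms] tangent_base by metis
  then show ?thesis
    by (simp add: tangent_chart_def)
qed

text \<open>Seen through the chart \<open>d\<close>, the set is the preimage of \<open>W\<close>
  under the coordinate expression of the field, which is continuous by the case of equal charts
  above.\<close>

lemma openin_translated_field_preimage:
  assumes d: "d \<in> atlas S" and W: "open W"
  shows "openin (mtopology S)
    {x \<in> fst d. (snd d x, snd (translated_field v x) d) \<in> W}"
proof -
  let ?h = "\<lambda>e. (snd d (chart_inv d e), snd (translated_field v (chart_inv d e)) d)"
  have "continuous_on (snd d ` fst d) ?h"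
    using smooth_on_imp_continuous_on[OF translated_field_in_charts[OF d d]]
    unfolding Int_absorb .
  then have "open (?h -` W \<inter> snd d ` fst d)"
    using W unfolding continuous_on_open_vimage[OF chart_image_open[OF d]] by (elim allE impE)
  from openin_chart_preimage[OF d this]
  have "openin (mtopology S) {x \<in> fst d. snd d x \<in> ?h -` W \<inter> snd d ` fst d}" .
  moreover have "{x \<in> fst d. snd d x \<in> ?h -` W \<inter> snd d ` fst d} =
      {x \<in> fst d. (snd d x, snd (translated_field v x) d) \<in> W}"
    by (simp add: chart_inv_chart[OF d] cong: conj_cong)
  ultimately show ?thesis
    by simp
qed

text \<open>For a generated topology it is enough to treat the generators, and to check that the
  image lies in their union, which is the carrier of that topology.\<close>

lemma continuous_translated_field:
  "continuous_map (mtopology S) (mtopology (tangent_bundle S)) (translated_field v)"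
  unfolding tangent_bundle_def manifold.simps
proof (rule continuous_on_generated_topo)
  let ?base = "{{t \<in> fst (tangent_chart S c). snd (tangent_chart S c) t \<in> W} | c W.
    c \<in> atlas S \<and> open W}"
  show "openin (mtopology S) (translated_field v -` U \<inter> points S)" if "U \<in> ?base" for U
  proof -
    from that obtain d W where d: "d \<in> atlas S" and W: "open W"
      and U: "U = {t \<in> fst (tangent_chart S d). snd (tangent_chart S d) t \<in> W}"
      by blast
    have "translated_field v -` U \<inter> points S =
        {x \<in> fst d. (snd d x, snd (translated_field v x) d) \<in> W}"
    proof (rule set_eqI)
      fix x
      show "x \<in> translated_field v -` U \<inter> points S \<longleftrightarrow>
          x \<in> {x \<in> fst d. (snd d x, snd (translated_field v x) d) \<in> W}"
      proof (cases "x \<in> points S")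
        case True
        then have "snd (tangent_chart S d) (translated_field v x) =
            (snd d x, snd (translated_field v x) d)"
          by (simp add: tangent_chart_def fst_translated_field)
        then show ?thesis
          using True by (simp add: U translated_field_in_tangent_chart)
      next
        case False
        then show ?thesis
          using chart_subset[OF d] by (simp add: subset_iff) blast
      qed
    qed
    then show ?thesis
      using openin_translated_field_preimage[OF d W] by simp
  qed
  show "translated_field v ` points S \<subseteq> \<Union> ?base"
  proof
    fix t
    assume "t \<in> translated_field v ` points S"
    then obtain x where x: "x \<in> points S" "t = translated_field v x"
      by blast
    \<comment> \<open>The generator with \<open>W = UNIV\<close> is the whole domain of a bundle
      chart.\<close>
    then have "t \<in> {t \<in> fst (tangent_chart S (chart_at S x)).
        snd (tangent_chart S (chart_at S x)) t \<in> UNIV}"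
      using translated_field_in_tangent_chart chart_at(2) by simp
    then show "t \<in> \<Union> ?base"
      using chart_at(1)[OF x(1)] open_UNIV by blast
  qed
qed

lemma smooth_translated_field: "smooth_map S (tangent_bundle S) (translated_field v)"
  unfolding smooth_map_def
proof (intro conjI ballI)
  show "continuous_map (mtopology S) (mtopology (tangent_bundle S)) (translated_field v)"
    by (rule continuous_translated_field)
next
  fix c D
  assume c: "c \<in> atlas S" and "D \<in> atlas (tangent_bundle S)"
  then obtain d where d: "d \<in> atlas S" and D: "D = tangent_chart S d"
    by (auto simp: tangent_bundle_def)
  \<comment> \<open>Since the field is a section, landing in a bundle chart is a condition on the
    base point only.\<close>
  have dom: "fst c \<inter> translated_field v -` fst D = fst c \<inter> fst d"
    using chart_subset[OF c] translated_field_in_tangent_chart D by blast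
  show "smooth_on (snd c ` (fst c \<inter> translated_field v -` fst D))
      (snd D \<circ> translated_field v \<circ> chart_inv c)"
    unfolding dom
  proof (rule smooth_on_cong[OF _ _ translated_field_in_charts[OF c d]])
    show "open (snd c ` (fst c \<inter> fst d))"
      using c chart_open[OF d] by (rule open_chart_image)
    show "(snd d (chart_inv c e), snd (translated_field v (chart_inv c e)) d) =
        (snd D \<circ> translated_field v \<circ> chart_inv c) e" if "e \<in> snd c ` (fst c \<inter> fst d)" for e
      using that chart_subset[OF c]
      by (auto simp: D tangent_chart_def chart_inv_chart[OF c] fst_translated_field subset_iff)
  qed
qed

section \<open>Left invariance and the value at the base point\<close>

text \<open>Both sides become derivatives of \<open>f\<close> along composed translations, taken at
  \<open>x0\<close> in direction \<open>v\<close>.\<close>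

lemma translated_field_left_invariant: "left_invariant S \<mu> (translated_field v)"
  unfolding left_invariant_def left_translations_def
proof clarify
  fix f x y z
  assume f: "f \<in> smooth_functions S" and x: "x \<in> points S" and y: "y \<in> points S"
    and z: "z \<in> points S"
  let ?l = "left_translation \<mu> x y" and ?c = "chart_at S z"
  have lz: "?l z \<in> points S" and lz': "?l z = \<mu> (x, y, z)"
    using product_closed x y z by (simp_all add: left_translation_def)
  have "(f \<circ> ?l \<circ> chart_inv ?c) differentiable (at (snd ?c z))"
    by (rule chart_chain_rule(1)[OF smooth_manifold_axioms smooth_manifold_axioms
        smooth_left_translation[OF x y] chart_at[OF z] chart_at[OF lz]
        smooth_functions_differentiable[OF f chart_at[OF lz]]])
  from chart_chain_rule_translated_field[OF chart_at[OF z] this]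
  have "tangent_apply S (translated_field v z) (f \<circ> ?l) =
      frechet_derivative (f \<circ> ?l \<circ> left_translation \<mu> z x0 \<circ> chart_inv base_chart)
        (at (snd base_chart x0)) (snd v base_chart)"
    by (simp add: tangent_apply_def Let_def fst_translated_field[OF z])
  also have "\<dots> =
      frechet_derivative (f \<circ> left_translation \<mu> (?l z) x0 \<circ> chart_inv base_chart)
        (at (snd base_chart x0)) (snd v base_chart)"
    \<comment> \<open>The composition law for translations holds at every point of the carrier,
      hence under the derivative at \<open>x0\<close>.\<close>
    using frechet_derivative_chart_cong[OF chart_at[OF basepoint],
        of "f \<circ> ?l \<circ> left_translation \<mu> z x0" "f \<circ> left_translation \<mu> (?l z) x0"]
      left_translation_comp[OF x y z]
    by (simp add: lz')
  also have "\<dots> = tangent_apply S (translated_field v (?l z)) f"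
    using tangent_apply_translated_field[OF lz f] by simp
  finally show "(pullback ?l \<circ> vector_field_operator S (translated_field v)) f z =
      (vector_field_operator S (translated_field v) \<circ> pullback ?l) f z"
    by (simp add: pullback_def vector_field_operator_def)
qed

text \<open>By the left unit law, translation by \<open>x0\<close> is the identity on the carrier.
  Its derivative from \<open>base_chart\<close> to another chart is then that of the transition map,
  and the transformation law of \<open>v\<close> recovers each component.\<close>

lemma translated_field_basepoint: "translated_field v x0 = v"
proof (rule prod_eqI)
  show "fst (translated_field v x0) = fst v"
    using fst_translated_field[OF basepoint] tangent_base[OF v] by simp
  show "snd (translated_field v x0) = snd v"
  proof
    fix d
    show "snd (translated_field v x0) d = snd v d"
    proof (cases "d \<in> charts_at S x0")
      case True
      then have "snd (translated_field v x0) d =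
          frechet_derivative (snd d \<circ> left_translation \<mu> x0 x0 \<circ> chart_inv base_chart)
            (at (snd base_chart x0)) (snd v base_chart)"
        by (simp add: charts_at_def snd_translated_field)
      also have "\<dots> = frechet_derivative (snd d \<circ> chart_inv base_chart)
            (at (snd base_chart x0)) (snd v base_chart)"
        using frechet_derivative_chart_cong[OF chart_at[OF basepoint],
            of "snd d \<circ> left_translation \<mu> x0 x0" "snd d"] left_unit
        by (simp add: left_translation_def)
      also have "\<dots> = snd v d"
        using tangent_transform[OF v chart_at_in_charts_at[OF basepoint] True] by (rule sym)
      finally show ?thesis .
    next
      case False
      then show ?thesis
        using tangent_outside[OF v] tangent_outside[OF translated_field_tangent[OF basepoint]]
        by simp
    qed
  qed
qed

end

end

theorem proposition2p42:
  fixes S :: "('a, 'e::euclidean_space) manifold"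
    and \<mu> :: "'a \<times> 'a \<times> 'a \<Rightarrow> 'a"
    and x0 :: 'a
    and v :: "('a, 'e) tangent_vector"
  assumes "biunital_lie_semiheap S \<mu> x0"
    and "v \<in> tangent_space S x0"
    and "v \<noteq> zero_tangent x0"
  shows "let V = (\<lambda>x. tangent_map S S (left_translation \<mu> x x0) v) in
           smooth_vector_field S V \<and> left_invariant S \<mu> V \<and> V x0 = v"
proof -
  interpret biunital_lie_semiheap S \<mu> x0
    by fact
  have "(\<lambda>x. tangent_map S S (left_translation \<mu> x x0) v) = translated_field v"
    by (simp add: fun_eq_iff translated_field_def)
  then show ?thesis
    using assms(2) translated_field_tangent smooth_translated_field
      translated_field_left_invariant translated_field_basepoint
    by (simp add: Let_def smooth_vector_field_def)
qed

end
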